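(* Let $A=(A,\cdot,\circ)$ be any two-sided skew brace. Then $(A*A)*\mathrm{Ann}_2(A)=1$.
   Context: A skew brace is a set $A=(A,\cdot,\circ)$ with two group operations $\cdot$ and $\circ$ such that $a\circ(b\cdot c)=(a\circ b)\cdot a^{-1}\cdot(a\circ c)$ for all $a,b,c\in A$, where $a^{-1}$ is the inverse of $a$ in $(A,\cdot)$. The two groups share the same identity element, denoted $1$; the trivial subgroup $\{1\}$ is also written $1$. The skew brace $A$ is two-sided if also $(b\cdot c)\circ a=(b\circ a)\cdot a^{-1}\cdot(c\circ a)$ for all $a,b,c\in A$. For $a,b\in A$ put $a*b=a^{-1}\cdot(a\circ b)\cdot b^{-1}$; for subsets $X,Y\subseteq A$, $X*Y$ is the subgroup of $(A,\cdot)$ generated by all $x*y$ with $x\in X$, $y\in Y$. An ideal of $A$ is a subset $I$ that is a normal subgroup of both $(A,\cdot)$ and $(A,\circ)$ with $a\cdot I=a\circ I$ for all $a\in A$; then $A/I$ is naturally a skew brace. The annihilator of $A$ is the ideal $\mathrm{Ann}(A)=\{a\in A\mid \forall x\in A:\ a*x=1=x*a\}\cap Z(A,\cdot)$, where $Z$ denotes the center of a group. The second annihilator $\mathrm{Ann}_2(A)$ is the unique ideal of $A$ containing $\mathrm{Ann}(A)$ with $\mathrm{Ann}(A/\mathrm{Ann}(A))=\mathrm{Ann}_2(A)/\mathrm{Ann}(A)$. *)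

theory Defs
  imports "HOL-Algebra.Generated_Groups"
begin

text \<open>
  A skew brace is represented by two groups on one carrier: \<open>M\<close> is the group
  \<open>(A, \<cdot>)\<close> and \<open>C\<close> is the group \<open>(A, \<circ>)\<close>. That the two identities agree is
  derived (\<open>one_eq\<close> below), not assumed.
\<close>

locale skew_brace = M: group M + C: group C
  for M :: "('a, 'm) monoid_scheme" and C :: "('a, 'n) monoid_scheme" +
  assumes carrier_eq: "carrier C = carrier M"
    and left_brace:
      "\<lbrakk>a \<in> carrier M; b \<in> carrier M; c \<in> carrier M\<rbrakk> \<Longrightarrow>
        a \<otimes>\<^bsub>C\<^esub> (b \<otimes>\<^bsub>M\<^esub> c) = (a \<otimes>\<^bsub>C\<^esub> b) \<otimes>\<^bsub>M\<^esub> inv\<^bsub>M\<^esub> a \<otimes>\<^bsub>M\<^esub> (a \<otimes>\<^bsub>C\<^esub> c)"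

locale two_sided_skew_brace = skew_brace M C
  for M :: "('a, 'm) monoid_scheme" and C :: "('a, 'n) monoid_scheme" +
  assumes right_brace:
      "\<lbrakk>a \<in> carrier M; b \<in> carrier M; c \<in> carrier M\<rbrakk> \<Longrightarrow>
        (b \<otimes>\<^bsub>M\<^esub> c) \<otimes>\<^bsub>C\<^esub> a = (b \<otimes>\<^bsub>C\<^esub> a) \<otimes>\<^bsub>M\<^esub> inv\<^bsub>M\<^esub> a \<otimes>\<^bsub>M\<^esub> (c \<otimes>\<^bsub>C\<^esub> a)"

definition star ::
    "('a, 'm) monoid_scheme \<Rightarrow> ('a, 'n) monoid_scheme \<Rightarrow> 'a \<Rightarrow> 'a \<Rightarrow> 'a"
  where "star M C a b = inv\<^bsub>M\<^esub> a \<otimes>\<^bsub>M\<^esub> (a \<otimes>\<^bsub>C\<^esub> b) \<otimes>\<^bsub>M\<^esub> inv\<^bsub>M\<^esub> b"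

definition star_set ::
    "('a, 'm) monoid_scheme \<Rightarrow> ('a, 'n) monoid_scheme \<Rightarrow> 'a set \<Rightarrow> 'a set \<Rightarrow> 'a set"
  where "star_set M C X Y = generate M {star M C x y | x y. x \<in> X \<and> y \<in> Y}"

definition group_center :: "('a, 'm) monoid_scheme \<Rightarrow> 'a set"
  where "group_center G =
    {z \<in> carrier G. \<forall>x \<in> carrier G. z \<otimes>\<^bsub>G\<^esub> x = x \<otimes>\<^bsub>G\<^esub> z}"

definition brace_ideal ::
    "('a, 'm) monoid_scheme \<Rightarrow> ('a, 'n) monoid_scheme \<Rightarrow> 'a set \<Rightarrow> bool"
  where "brace_ideal M C I \<longleftrightarrow>
    I \<lhd> M \<and> I \<lhd> C \<and> (\<forall>a \<in> carrier M. a <#\<^bsub>M\<^esub> I = a <#\<^bsub>C\<^esub> I)"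

definition annihilator ::
    "('a, 'm) monoid_scheme \<Rightarrow> ('a, 'n) monoid_scheme \<Rightarrow> 'a set"
  where "annihilator M C =
    {a \<in> carrier M. \<forall>x \<in> carrier M.
        star M C a x = \<one>\<^bsub>M\<^esub> \<and> star M C x a = \<one>\<^bsub>M\<^esub>} \<inter> group_center M"

text \<open>
  For an ideal \<open>I\<close> the quotient skew brace \<open>A/I\<close> is the pair \<open>M Mod I\<close>, \<open>C Mod I\<close>;
  see \<open>quotient_skew_brace\<close> below. For \<open>I \<subseteq> J\<close> the subset \<open>J/I\<close> of \<open>A/I\<close> is the set of
  cosets of \<open>I\<close> by elements of \<open>J\<close>.
\<close>

definition is_second_annihilator ::
    "('a, 'm) monoid_scheme \<Rightarrow> ('a, 'n) monoid_scheme \<Rightarrow> 'a set \<Rightarrow> bool"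
  where "is_second_annihilator M C J \<longleftrightarrow>
    brace_ideal M C J \<and> annihilator M C \<subseteq> J \<and>
    annihilator (M Mod annihilator M C) (C Mod annihilator M C) =
      (\<lambda>a. annihilator M C #>\<^bsub>M\<^esub> a) ` J"

text \<open>
  The description is justified by \<open>ex1_second_annihilator\<close> below: in every skew brace
  exactly one set satisfies \<^const>\<open>is_second_annihilator\<close>.
\<close>

definition second_annihilator ::
    "('a, 'm) monoid_scheme \<Rightarrow> ('a, 'n) monoid_scheme \<Rightarrow> 'a set"
  where "second_annihilator M C = (THE J. is_second_annihilator M C J)"


context skew_brace
begin

lemma C_closed: "x \<in> carrier M \<Longrightarrow> y \<in> carrier M \<Longrightarrow> x \<otimes>\<^bsub>C\<^esub> y \<in> carrier M"
  using C.m_closed carrier_eq by simp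

lemma one_eq: "\<one>\<^bsub>C\<^esub> = \<one>\<^bsub>M\<^esub>"
proof -
  have c: "\<one>\<^bsub>C\<^esub> \<in> carrier M"
    using C.one_closed carrier_eq by simp
  have m: "\<one>\<^bsub>M\<^esub> \<in> carrier C"
    using carrier_eq by simp
  have "\<one>\<^bsub>C\<^esub> \<otimes>\<^bsub>C\<^esub> (\<one>\<^bsub>M\<^esub> \<otimes>\<^bsub>M\<^esub> \<one>\<^bsub>M\<^esub>)
      = (\<one>\<^bsub>C\<^esub> \<otimes>\<^bsub>C\<^esub> \<one>\<^bsub>M\<^esub>) \<otimes>\<^bsub>M\<^esub> inv\<^bsub>M\<^esub> \<one>\<^bsub>C\<^esub> \<otimes>\<^bsub>M\<^esub> (\<one>\<^bsub>C\<^esub> \<otimes>\<^bsub>C\<^esub> \<one>\<^bsub>M\<^esub>)"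
    using left_brace[OF c M.one_closed M.one_closed] .
  then have "inv\<^bsub>M\<^esub> \<one>\<^bsub>C\<^esub> = \<one>\<^bsub>M\<^esub>"
    using c m by simp
  then show ?thesis
    using c M.inv_eq_1_iff by simp
qed

lemma star_eq_one_iff:
  assumes a: "a \<in> carrier M" and b: "b \<in> carrier M"
  shows "star M C a b = \<one>\<^bsub>M\<^esub> \<longleftrightarrow> a \<otimes>\<^bsub>C\<^esub> b = a \<otimes>\<^bsub>M\<^esub> b"
proof
  assume "star M C a b = \<one>\<^bsub>M\<^esub>"
  then have "inv\<^bsub>M\<^esub> (inv\<^bsub>M\<^esub> b) = inv\<^bsub>M\<^esub> a \<otimes>\<^bsub>M\<^esub> (a \<otimes>\<^bsub>C\<^esub> b)"
    unfolding star_def using a b C_closed by (intro M.inv_equality) simp_all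
  then have "a \<otimes>\<^bsub>M\<^esub> b = a \<otimes>\<^bsub>M\<^esub> (inv\<^bsub>M\<^esub> a \<otimes>\<^bsub>M\<^esub> (a \<otimes>\<^bsub>C\<^esub> b))"
    using b by simp
  then show "a \<otimes>\<^bsub>C\<^esub> b = a \<otimes>\<^bsub>M\<^esub> b"
    using a b C_closed by (simp add: M.m_assoc[symmetric])
next
  assume "a \<otimes>\<^bsub>C\<^esub> b = a \<otimes>\<^bsub>M\<^esub> b"
  then show "star M C a b = \<one>\<^bsub>M\<^esub>"
    unfolding star_def using a b by (simp add: M.m_assoc[symmetric])
qed

lemma mem_annihilator_iff:
  "a \<in> annihilator M C \<longleftrightarrow> a \<in> carrier M \<and>
    (\<forall>x \<in> carrier M. a \<otimes>\<^bsub>C\<^esub> x = a \<otimes>\<^bsub>M\<^esub> x \<and> x \<otimes>\<^bsub>C\<^esub> a = x \<otimes>\<^bsub>M\<^esub> a \<and> a \<otimes>\<^bsub>M\<^esub> x = x \<otimes>\<^bsub>M\<^esub> a)"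
  unfolding annihilator_def group_center_def using star_eq_one_iff by auto

lemma annihilatorD:
  assumes "a \<in> annihilator M C"
  shows "a \<in> carrier M"
    and "x \<in> carrier M \<Longrightarrow> a \<otimes>\<^bsub>C\<^esub> x = a \<otimes>\<^bsub>M\<^esub> x"
    and "x \<in> carrier M \<Longrightarrow> x \<otimes>\<^bsub>C\<^esub> a = x \<otimes>\<^bsub>M\<^esub> a"
    and "x \<in> carrier M \<Longrightarrow> a \<otimes>\<^bsub>M\<^esub> x = x \<otimes>\<^bsub>M\<^esub> a"
  using assms mem_annihilator_iff by blast+

lemma annihilator_inv:
  assumes a: "a \<in> annihilator M C"
  shows "inv\<^bsub>C\<^esub> a = inv\<^bsub>M\<^esub> a" "inv\<^bsub>M\<^esub> a \<in> annihilator M C"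
proof -
  note aM = annihilatorD(1)[OF a] and aC = annihilatorD(2)[OF a]
    and Ca = annihilatorD(3)[OF a] and com = annihilatorD(4)[OF a]
  let ?b = "inv\<^bsub>M\<^esub> a"
  have b: "?b \<in> carrier M" using aM by simp
  have "?b \<otimes>\<^bsub>C\<^esub> a = \<one>\<^bsub>C\<^esub>" using Ca[OF b] aM one_eq by simp
  then show inv: "inv\<^bsub>C\<^esub> a = ?b"
    using C.inv_equality aM b carrier_eq by simp
  have "?b \<otimes>\<^bsub>C\<^esub> x = ?b \<otimes>\<^bsub>M\<^esub> x \<and> x \<otimes>\<^bsub>C\<^esub> ?b = x \<otimes>\<^bsub>M\<^esub> ?b \<and> ?b \<otimes>\<^bsub>M\<^esub> x = x \<otimes>\<^bsub>M\<^esub> ?b"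
    if x: "x \<in> carrier M" for x
  proof (intro conjI)
    have y: "?b \<otimes>\<^bsub>M\<^esub> x \<in> carrier M" and z: "x \<otimes>\<^bsub>M\<^esub> ?b \<in> carrier M"
      using x b by simp_all
    have "a \<otimes>\<^bsub>C\<^esub> (?b \<otimes>\<^bsub>M\<^esub> x) = x"
      using aC[OF y] aM b x by (simp add: M.m_assoc[symmetric])
    then show "?b \<otimes>\<^bsub>C\<^esub> x = ?b \<otimes>\<^bsub>M\<^esub> x"
      using C.inv_solve_left'[of "?b \<otimes>\<^bsub>M\<^esub> x" a x] inv aM x y carrier_eq by simp
    have "(x \<otimes>\<^bsub>M\<^esub> ?b) \<otimes>\<^bsub>C\<^esub> a = x"
      using Ca[OF z] aM b x by (simp add: M.m_assoc)
    then show "x \<otimes>\<^bsub>C\<^esub> ?b = x \<otimes>\<^bsub>M\<^esub> ?b"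
      using C.inv_solve_right'[of "x \<otimes>\<^bsub>M\<^esub> ?b" x a] inv aM x z carrier_eq by simp
    show "?b \<otimes>\<^bsub>M\<^esub> x = x \<otimes>\<^bsub>M\<^esub> ?b"
    proof -
      have "x = a \<otimes>\<^bsub>M\<^esub> (x \<otimes>\<^bsub>M\<^esub> ?b)"
        using com[OF z] aM x b by (simp add: M.m_assoc)
      then show ?thesis
        using M.inv_solve_left'[of "x \<otimes>\<^bsub>M\<^esub> ?b" a x] aM x z by simp
    qed
  qed
  then show "?b \<in> annihilator M C"
    using mem_annihilator_iff b by blast
qed

lemma annihilator_mult:
  assumes a: "a \<in> annihilator M C" and b: "b \<in> annihilator M C"
  shows "a \<otimes>\<^bsub>M\<^esub> b \<in> annihilator M C"
proof -
  note A = annihilatorD[OF a] and B = annihilatorD[OF b]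
  have ab: "a \<otimes>\<^bsub>M\<^esub> b = a \<otimes>\<^bsub>C\<^esub> b" using A(2) B(1) by simp
  have "(a \<otimes>\<^bsub>M\<^esub> b) \<otimes>\<^bsub>C\<^esub> x = (a \<otimes>\<^bsub>M\<^esub> b) \<otimes>\<^bsub>M\<^esub> x \<and> x \<otimes>\<^bsub>C\<^esub> (a \<otimes>\<^bsub>M\<^esub> b) = x \<otimes>\<^bsub>M\<^esub> (a \<otimes>\<^bsub>M\<^esub> b)
      \<and> (a \<otimes>\<^bsub>M\<^esub> b) \<otimes>\<^bsub>M\<^esub> x = x \<otimes>\<^bsub>M\<^esub> (a \<otimes>\<^bsub>M\<^esub> b)" if x: "x \<in> carrier M" for x
  proof (intro conjI)
    have "(a \<otimes>\<^bsub>M\<^esub> b) \<otimes>\<^bsub>C\<^esub> x = a \<otimes>\<^bsub>C\<^esub> (b \<otimes>\<^bsub>C\<^esub> x)"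
      unfolding ab using A(1) B(1) x carrier_eq by (simp add: C.m_assoc)
    also have "\<dots> = a \<otimes>\<^bsub>M\<^esub> (b \<otimes>\<^bsub>M\<^esub> x)"
      using A(2)[of "b \<otimes>\<^bsub>M\<^esub> x"] B(1) B(2)[OF x] x by simp
    finally show "(a \<otimes>\<^bsub>M\<^esub> b) \<otimes>\<^bsub>C\<^esub> x = (a \<otimes>\<^bsub>M\<^esub> b) \<otimes>\<^bsub>M\<^esub> x"
      using A(1) B(1) x by (simp add: M.m_assoc)
    have "x \<otimes>\<^bsub>C\<^esub> (a \<otimes>\<^bsub>M\<^esub> b) = (x \<otimes>\<^bsub>C\<^esub> a) \<otimes>\<^bsub>C\<^esub> b"
      unfolding ab using A(1) B(1) x carrier_eq by (simp add: C.m_assoc)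
    also have "\<dots> = (x \<otimes>\<^bsub>M\<^esub> a) \<otimes>\<^bsub>M\<^esub> b"
      using B(3)[of "x \<otimes>\<^bsub>M\<^esub> a"] A(1) A(3)[OF x] x by simp
    finally show "x \<otimes>\<^bsub>C\<^esub> (a \<otimes>\<^bsub>M\<^esub> b) = x \<otimes>\<^bsub>M\<^esub> (a \<otimes>\<^bsub>M\<^esub> b)"
      using A(1) B(1) x by (simp add: M.m_assoc)
    have "(a \<otimes>\<^bsub>M\<^esub> b) \<otimes>\<^bsub>M\<^esub> x = a \<otimes>\<^bsub>M\<^esub> (x \<otimes>\<^bsub>M\<^esub> b)"
      unfolding B(4)[OF x, symmetric] using A(1) B(1) x by (simp add: M.m_assoc)
    also have "\<dots> = (a \<otimes>\<^bsub>M\<^esub> x) \<otimes>\<^bsub>M\<^esub> b"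
      using A(1) B(1) x by (simp add: M.m_assoc)
    also have "\<dots> = x \<otimes>\<^bsub>M\<^esub> (a \<otimes>\<^bsub>M\<^esub> b)"
      unfolding A(4)[OF x] using A(1) B(1) x by (simp add: M.m_assoc)
    finally show "(a \<otimes>\<^bsub>M\<^esub> b) \<otimes>\<^bsub>M\<^esub> x = x \<otimes>\<^bsub>M\<^esub> (a \<otimes>\<^bsub>M\<^esub> b)" .
  qed
  then show ?thesis
    using mem_annihilator_iff A(1) B(1) by blast
qed

lemma annihilator_ideal: "brace_ideal M C (annihilator M C)"
proof -
  let ?I = "annihilator M C"
  have sub: "?I \<subseteq> carrier M" using annihilatorD(1) by blast
  have one: "\<one>\<^bsub>M\<^esub> \<in> ?I"
    unfolding mem_annihilator_iff
    using C.l_one C.r_one unfolding carrier_eq one_eq by simp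
  then have ne: "?I \<noteq> {}" by blast
  have SM: "subgroup ?I M"
    by (rule M.subgroupI[OF sub ne annihilator_inv(2) annihilator_mult])
  have SC: "subgroup ?I C"
  proof (rule C.subgroupI[OF _ ne])
    show "?I \<subseteq> carrier C" using sub carrier_eq by simp
    show "inv\<^bsub>C\<^esub> a \<in> ?I" if "a \<in> ?I" for a
      using annihilator_inv[OF that] by simp
    show "a \<otimes>\<^bsub>C\<^esub> b \<in> ?I" if "a \<in> ?I" "b \<in> ?I" for a b
      using annihilator_mult[OF that] annihilatorD(1)[OF that(2)]
        annihilatorD(2)[OF that(1)] by simp
  qed
  have lc: "x <#\<^bsub>M\<^esub> ?I = x <#\<^bsub>C\<^esub> ?I" if "x \<in> carrier M" for x
    unfolding l_coset_def using annihilatorD(3) that by (intro SUP_cong) simp_all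
  have rM: "?I #>\<^bsub>M\<^esub> x = x <#\<^bsub>M\<^esub> ?I" if "x \<in> carrier M" for x
    unfolding l_coset_def r_coset_def using annihilatorD(4) that by (intro SUP_cong) simp_all
  have "?I #>\<^bsub>C\<^esub> x = ?I #>\<^bsub>M\<^esub> x" if "x \<in> carrier M" for x
    unfolding r_coset_def using annihilatorD(2) that by (intro SUP_cong) simp_all
  then have rC: "?I #>\<^bsub>C\<^esub> x = x <#\<^bsub>C\<^esub> ?I" if "x \<in> carrier M" for x
    using lc rM that by simp
  show ?thesis
    unfolding brace_ideal_def normal_def normal_axioms_def
    using SM SC lc rM rC carrier_eq M.group_axioms C.group_axioms by simp
qed

lemma ideal_r_coset_eq:
  assumes "brace_ideal M C I" "a \<in> carrier M"
  shows "I #>\<^bsub>C\<^esub> a = I #>\<^bsub>M\<^esub> a"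
proof -
  have "a \<in> carrier C" using assms(2) carrier_eq by simp
  then have "I #>\<^bsub>C\<^esub> a = a <#\<^bsub>C\<^esub> I"
    using assms(1) normal.coset_eq unfolding brace_ideal_def by blast
  moreover have "I #>\<^bsub>M\<^esub> a = a <#\<^bsub>M\<^esub> I"
    using assms normal.coset_eq unfolding brace_ideal_def by blast
  ultimately show ?thesis
    using assms unfolding brace_ideal_def by simp
qed

lemma quotient_skew_brace:
  assumes I: "brace_ideal M C I"
  shows "skew_brace (M Mod I) (C Mod I)"
proof -
  interpret NM: normal I M using I brace_ideal_def by blast
  interpret NC: normal I C using I brace_ideal_def by blast
  note r = ideal_r_coset_eq[OF I]
  have car: "carrier (C Mod I) = carrier (M Mod I)"
    using r carrier_eq by (simp add: carrier_FactGroup)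
  have multM: "(I #>\<^bsub>M\<^esub> x) <#>\<^bsub>M\<^esub> (I #>\<^bsub>M\<^esub> y) = I #>\<^bsub>M\<^esub> (x \<otimes>\<^bsub>M\<^esub> y)"
    if "x \<in> carrier M" "y \<in> carrier M" for x y
    using that NM.rcos_sum by simp
  have multC: "(I #>\<^bsub>M\<^esub> x) <#>\<^bsub>C\<^esub> (I #>\<^bsub>M\<^esub> y) = I #>\<^bsub>M\<^esub> (x \<otimes>\<^bsub>C\<^esub> y)"
    if "x \<in> carrier M" "y \<in> carrier M" for x y
    using that NC.rcos_sum[of x y] carrier_eq r C_closed by simp
  have invM: "inv\<^bsub>M Mod I\<^esub> (I #>\<^bsub>M\<^esub> x) = I #>\<^bsub>M\<^esub> (inv\<^bsub>M\<^esub> x)" if "x \<in> carrier M" for x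
    using that NM.inv_FactGroup NM.rcos_inv carrier_FactGroup by (metis imageI)
  show ?thesis
  proof (intro skew_brace.intro skew_brace_axioms.intro)
    show "group (M Mod I)" "group (C Mod I)"
      using NM.factorgroup_is_group NC.factorgroup_is_group .
    show "carrier (C Mod I) = carrier (M Mod I)" by (rule car)
  next
    fix a b c
    assume "a \<in> carrier (M Mod I)" "b \<in> carrier (M Mod I)" "c \<in> carrier (M Mod I)"
    then obtain x y z where x: "x \<in> carrier M" "a = I #>\<^bsub>M\<^esub> x"
      and y: "y \<in> carrier M" "b = I #>\<^bsub>M\<^esub> y" and z: "z \<in> carrier M" "c = I #>\<^bsub>M\<^esub> z"
      by (auto simp: carrier_FactGroup)
    show "a \<otimes>\<^bsub>C Mod I\<^esub> (b \<otimes>\<^bsub>M Mod I\<^esub> c)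
        = (a \<otimes>\<^bsub>C Mod I\<^esub> b) \<otimes>\<^bsub>M Mod I\<^esub> inv\<^bsub>M Mod I\<^esub> a \<otimes>\<^bsub>M Mod I\<^esub> (a \<otimes>\<^bsub>C Mod I\<^esub> c)"
      using x y z left_brace[OF x(1) y(1) z(1)] by (simp add: multM multC invM C_closed)
  qed
qed

lemma ideal_preimage:
  fixes M' :: "('b, 'k) monoid_scheme" and C' :: "('b, 'l) monoid_scheme"
  assumes B: "skew_brace M' C'"
    and homM: "h \<in> hom M M'" and homC: "h \<in> hom C C'"
    and K: "brace_ideal M' C' K"
  shows "brace_ideal M C {a \<in> carrier M. h a \<in> K}"
proof -
  interpret B: skew_brace M' C' by (rule B)
  interpret HM: group_hom M M' h using homM by unfold_locales
  interpret HC: group_hom C C' h using homC by unfold_locales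
  interpret NM: normal K M' using K brace_ideal_def by blast
  interpret NC: normal K C' using K brace_ideal_def by blast
  let ?J = "{a \<in> carrier M. h a \<in> K}"
  have hM [simp]: "x \<in> carrier M \<Longrightarrow> h x \<in> carrier M'" for x
    using HM.hom_closed .
  have SM: "subgroup ?J M"
  proof (rule M.subgroupI)
    show "?J \<noteq> {}" using HM.hom_one NM.one_closed by force
  qed auto
  have SC: "subgroup ?J C"
  proof (rule C.subgroupI)
    show "?J \<subseteq> carrier C" using carrier_eq by auto
    show "?J \<noteq> {}" using SM subgroup.one_closed by blast
    show "inv\<^bsub>C\<^esub> a \<in> ?J" if "a \<in> ?J" for a
    proof -
      have "a \<in> carrier C" "h a \<in> K" using that carrier_eq by auto
      then show ?thesis using C.inv_closed[of a] carrier_eq by simp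
    qed
    show "a \<otimes>\<^bsub>C\<^esub> b \<in> ?J" if "a \<in> ?J" "b \<in> ?J" for a b
    proof -
      have "a \<in> carrier C" "h a \<in> K" "b \<in> carrier C" "h b \<in> K" using that carrier_eq by auto
      then show ?thesis using C.m_closed[of a b] carrier_eq by simp
    qed
  qed
  have NM': "?J \<lhd> M"
    by (intro M.normal_invI[OF SM]) (auto intro: NM.inv_op_closed2)
  have NC': "?J \<lhd> C"
  proof (intro C.normal_invI[OF SC])
    fix x y assume x: "x \<in> carrier C" and "y \<in> ?J"
    then have y: "y \<in> carrier C" "h y \<in> K" using carrier_eq by auto
    have "x \<otimes>\<^bsub>C\<^esub> y \<otimes>\<^bsub>C\<^esub> inv\<^bsub>C\<^esub> x \<in> carrier C" using x y by simp
    moreover have "h (x \<otimes>\<^bsub>C\<^esub> y \<otimes>\<^bsub>C\<^esub> inv\<^bsub>C\<^esub> x) \<in> K"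
      using x y NC.inv_op_closed2[of "h x" "h y"] by simp
    ultimately show "x \<otimes>\<^bsub>C\<^esub> y \<otimes>\<^bsub>C\<^esub> inv\<^bsub>C\<^esub> x \<in> ?J" using carrier_eq by simp
  qed
  have cos: "a <#\<^bsub>M\<^esub> ?J = a <#\<^bsub>C\<^esub> ?J" if a: "a \<in> carrier M" for a
  proof -
    have aC: "a \<in> carrier C" using a carrier_eq by simp
    have ha: "h a \<in> carrier M'" using a by simp
    have lc: "h a <#\<^bsub>M'\<^esub> K = h a <#\<^bsub>C'\<^esub> K"
      using K ha unfolding brace_ideal_def by blast
    have "y \<in> a <#\<^bsub>M\<^esub> ?J \<longleftrightarrow> y \<in> carrier M \<and> h y \<in> h a <#\<^bsub>M'\<^esub> K" for y
    proof
      assume "y \<in> a <#\<^bsub>M\<^esub> ?J"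
      then show "y \<in> carrier M \<and> h y \<in> h a <#\<^bsub>M'\<^esub> K"
        using a unfolding l_coset_def by auto
    next
      assume y: "y \<in> carrier M \<and> h y \<in> h a <#\<^bsub>M'\<^esub> K"
      then obtain k where k: "k \<in> K" "h y = h a \<otimes>\<^bsub>M'\<^esub> k"
        unfolding l_coset_def by auto
      have "h (inv\<^bsub>M\<^esub> a \<otimes>\<^bsub>M\<^esub> y) = k"
        using a y k by (simp add: B.M.m_assoc[symmetric])
      then have "inv\<^bsub>M\<^esub> a \<otimes>\<^bsub>M\<^esub> y \<in> ?J" using a y k by simp
      moreover have "y = a \<otimes>\<^bsub>M\<^esub> (inv\<^bsub>M\<^esub> a \<otimes>\<^bsub>M\<^esub> y)"
        using a y by (simp add: M.m_assoc[symmetric])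
      ultimately show "y \<in> a <#\<^bsub>M\<^esub> ?J" unfolding l_coset_def by blast
    qed
    moreover have "y \<in> a <#\<^bsub>C\<^esub> ?J \<longleftrightarrow> y \<in> carrier M \<and> h y \<in> h a <#\<^bsub>C'\<^esub> K" for y
    proof
      assume "y \<in> a <#\<^bsub>C\<^esub> ?J"
      then show "y \<in> carrier M \<and> h y \<in> h a <#\<^bsub>C'\<^esub> K"
        using aC unfolding l_coset_def by (auto simp flip: carrier_eq)
    next
      assume y: "y \<in> carrier M \<and> h y \<in> h a <#\<^bsub>C'\<^esub> K"
      then have yC: "y \<in> carrier C" using carrier_eq by simp
      obtain k where k: "k \<in> K" "h y = h a \<otimes>\<^bsub>C'\<^esub> k"
        using y unfolding l_coset_def by auto
      have "h (inv\<^bsub>C\<^esub> a \<otimes>\<^bsub>C\<^esub> y) = k"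
        using aC yC k by (simp add: B.C.m_assoc[symmetric])
      then have "inv\<^bsub>C\<^esub> a \<otimes>\<^bsub>C\<^esub> y \<in> ?J"
        using aC yC k by (simp flip: carrier_eq)
      moreover have "y = a \<otimes>\<^bsub>C\<^esub> (inv\<^bsub>C\<^esub> a \<otimes>\<^bsub>C\<^esub> y)"
        using aC yC by (simp add: C.m_assoc[symmetric])
      ultimately show "y \<in> a <#\<^bsub>C\<^esub> ?J" unfolding l_coset_def by blast
    qed
    ultimately show ?thesis using lc by blast
  qed
  show ?thesis
    unfolding brace_ideal_def using NM' NC' cos by blast
qed

theorem ex1_second_annihilator: "\<exists>!J. is_second_annihilator M C J"
proof -
  let ?I = "annihilator M C"
  let ?h = "\<lambda>a. ?I #>\<^bsub>M\<^esub> a"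
  let ?K = "annihilator (M Mod ?I) (C Mod ?I)"
  let ?J = "{a \<in> carrier M. ?h a \<in> ?K}"
  interpret NM: normal ?I M using annihilator_ideal brace_ideal_def by blast
  interpret NC: normal ?I C using annihilator_ideal brace_ideal_def by blast
  have Q: "skew_brace (M Mod ?I) (C Mod ?I)"
    by (rule quotient_skew_brace[OF annihilator_ideal])
  interpret Q: skew_brace "M Mod ?I" "C Mod ?I" by (rule Q)
  have "?h \<in> hom C (C Mod ?I)"
  proof -
    have "(\<lambda>a. ?I #>\<^bsub>C\<^esub> a) \<in> hom C (C Mod ?I)" by (rule NC.r_coset_hom_Mod)
    then show ?thesis
      using ideal_r_coset_eq[OF annihilator_ideal] carrier_eq C_closed
      by (auto simp: hom_def Pi_def)
  qed
  then have J: "brace_ideal M C ?J"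
    using ideal_preimage[OF Q NM.r_coset_hom_Mod _ Q.annihilator_ideal] by blast
  have Ksub: "?K \<subseteq> carrier (M Mod ?I)"
    using Q.mem_annihilator_iff by blast
  have sub: "?I \<subseteq> ?J"
  proof
    fix a assume a: "a \<in> ?I"
    then have "?h a = \<one>\<^bsub>M Mod ?I\<^esub>" using NM.rcos_const by simp
    moreover have "\<one>\<^bsub>M Mod ?I\<^esub> \<in> ?K"
      using Q.annihilator_ideal unfolding brace_ideal_def normal_def
      by (blast intro: subgroup.one_closed)
    ultimately show "a \<in> ?J" using a NM.subset by auto
  qed
  have im: "?K = ?h ` ?J"
    using Ksub by (auto simp: carrier_FactGroup)
  show ?thesis
  proof (rule ex1I[of _ ?J])
    show "is_second_annihilator M C ?J"
      unfolding is_second_annihilator_def using J sub im by blast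
  next
    fix L assume "is_second_annihilator M C L"
    then have L: "brace_ideal M C L" "?I \<subseteq> L" "?K = ?h ` L"
      unfolding is_second_annihilator_def by auto
    have SL: "subgroup L M" using L(1) unfolding brace_ideal_def normal_def by blast
    show "L = ?J"
    proof
      show "L \<subseteq> ?J" using L(3) subgroup.subset[OF SL] by blast
      show "?J \<subseteq> L"
      proof
        fix a assume a: "a \<in> ?J"
        then obtain l where l: "l \<in> L" "?h a = ?h l" using L(3) by auto
        have "a \<in> ?h l" using a l M.rcos_self[OF _ NM.subgroup_axioms, of a] by auto
        then obtain i where "i \<in> ?I" "a = i \<otimes>\<^bsub>M\<^esub> l" unfolding r_coset_def by auto
        then show "a \<in> L" using L(2) l subgroup.m_closed[OF SL] by blast
      qed
    qed
  qed
qed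

end

end

theory Submission
  imports Defs
begin

text \<open>
  Fix \<open>z\<close> in the second annihilator and consider the map \<open>b \<mapsto> b * z\<close>. Its values lie in the
  annihilator, because \<open>b \<circ> z\<close> and \<open>b \<cdot> z\<close> agree modulo it (\<open>star_second_annihilator\<close>). Central
  values are exactly what is needed for the right brace law to make the map a homomorphism from
  \<open>(A, \<cdot>)\<close> (\<open>star_mult_left\<close>). Comparing the two bracketings of \<open>a \<circ> b \<circ> z\<close> shows that it is
  also a homomorphism from \<open>(A, \<circ>)\<close> (\<open>star_circ_left\<close>). Now \<open>a \<circ> b = a \<cdot> (a * b) \<cdot> b\<close>, so
  applying the map to both sides gives \<open>(a * z) \<cdot> (b * z) = (a * z) \<cdot> ((a * b) * z) \<cdot> (b * z)\<close>,
  hence \<open>(a * b) * z = 1\<close>. The kernel of the map is a subgroup of \<open>(A, \<cdot>)\<close> and therefore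
  contains the subgroup \<open>A * A\<close> generated by the elements \<open>a * b\<close>.
\<close>

context skew_brace
begin

lemma star_closed:
  "a \<in> carrier M \<Longrightarrow> b \<in> carrier M \<Longrightarrow> star M C a b \<in> carrier M"
  unfolding star_def using C_closed by simp

lemma circ_eq_mult_star:
  assumes "a \<in> carrier M" "b \<in> carrier M"
  shows "a \<otimes>\<^bsub>C\<^esub> b = a \<otimes>\<^bsub>M\<^esub> star M C a b \<otimes>\<^bsub>M\<^esub> b"
  unfolding star_def using assms C_closed
  by (simp add: M.m_assoc[symmetric]) (simp add: M.m_assoc)

lemma star_eqI:
  assumes "a \<in> carrier M" "b \<in> carrier M" "u \<in> carrier M"
    and "a \<otimes>\<^bsub>C\<^esub> b = a \<otimes>\<^bsub>M\<^esub> u \<otimes>\<^bsub>M\<^esub> b"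
  shows "star M C a b = u"
  using assms circ_eq_mult_star[of a b] star_closed[of a b]
  by (simp add: M.right_cancel)

lemma second_annihilator_closed:
  assumes "z \<in> second_annihilator M C"
  shows "z \<in> carrier M"
proof -
  have "is_second_annihilator M C (second_annihilator M C)"
    unfolding second_annihilator_def by (rule theI'[OF ex1_second_annihilator])
  then have "subgroup (second_annihilator M C) M"
    unfolding is_second_annihilator_def brace_ideal_def normal_def by blast
  then show ?thesis
    using assms subgroup.subset by blast
qed

text \<open>
  The coset of \<open>z\<close> annihilates the quotient by \<open>Ann(A)\<close>, so \<open>b \<circ> z\<close> and \<open>b \<cdot> z\<close> differ by a factor
  in \<open>Ann(A)\<close>; this factor is central, so it can be moved between \<open>b\<close> and \<open>z\<close>, where it is
  \<open>b * z\<close>.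
\<close>

lemma star_second_annihilator:
  assumes z: "z \<in> second_annihilator M C" and b: "b \<in> carrier M"
  shows "star M C b z \<in> annihilator M C"
proof -
  let ?I = "annihilator M C"
  interpret NM: normal ?I M using annihilator_ideal brace_ideal_def by blast
  interpret NC: normal ?I C using annihilator_ideal brace_ideal_def by blast
  interpret Q: skew_brace "M Mod ?I" "C Mod ?I"
    by (rule quotient_skew_brace[OF annihilator_ideal])
  note r = ideal_r_coset_eq[OF annihilator_ideal]
  have zM: "z \<in> carrier M" using z by (rule second_annihilator_closed)
  have "is_second_annihilator M C (second_annihilator M C)"
    unfolding second_annihilator_def by (rule theI'[OF ex1_second_annihilator])
  then have "?I #>\<^bsub>M\<^esub> z \<in> annihilator (M Mod ?I) (C Mod ?I)"
    using z unfolding is_second_annihilator_def by blast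
  moreover have "?I #>\<^bsub>M\<^esub> b \<in> carrier (M Mod ?I)"
    using b by (auto simp: carrier_FactGroup)
  ultimately have "(?I #>\<^bsub>M\<^esub> b) <#>\<^bsub>C\<^esub> (?I #>\<^bsub>M\<^esub> z) = (?I #>\<^bsub>M\<^esub> b) <#>\<^bsub>M\<^esub> (?I #>\<^bsub>M\<^esub> z)"
    using Q.annihilatorD(3) by fastforce
  moreover have "(?I #>\<^bsub>M\<^esub> b) <#>\<^bsub>C\<^esub> (?I #>\<^bsub>M\<^esub> z) = ?I #>\<^bsub>M\<^esub> (b \<otimes>\<^bsub>C\<^esub> z)"
    using b zM NC.rcos_sum[of b z] carrier_eq r C_closed by simp
  ultimately have "?I #>\<^bsub>M\<^esub> (b \<otimes>\<^bsub>C\<^esub> z) = ?I #>\<^bsub>M\<^esub> (b \<otimes>\<^bsub>M\<^esub> z)"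
    using b zM NM.rcos_sum by simp
  then have "b \<otimes>\<^bsub>C\<^esub> z \<in> ?I #>\<^bsub>M\<^esub> (b \<otimes>\<^bsub>M\<^esub> z)"
    using M.rcos_self[OF C_closed[OF b zM] NM.subgroup_axioms] by simp
  then obtain i where i: "i \<in> ?I" "b \<otimes>\<^bsub>C\<^esub> z = i \<otimes>\<^bsub>M\<^esub> (b \<otimes>\<^bsub>M\<^esub> z)"
    unfolding r_coset_def by auto
  note I = annihilatorD[OF i(1)]
  have "b \<otimes>\<^bsub>C\<^esub> z = b \<otimes>\<^bsub>M\<^esub> i \<otimes>\<^bsub>M\<^esub> z"
    using i(2) I(1) I(4)[OF b] b zM by (simp add: M.m_assoc[symmetric])
  then show ?thesis
    using star_eqI[OF b zM I(1)] i(1) by simp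
qed

text \<open>
  Both bracketings of \<open>a \<circ> b \<circ> z\<close> are expanded: since \<open>b * z\<close> annihilates,
  \<open>b \<circ> z = (b \<cdot> z) \<circ> (b * z)\<close>, so \<open>b * z\<close> splits off from \<open>a \<circ> (b \<circ> z)\<close> on the right. The left
  brace law applied to the remaining \<open>a \<circ> (b \<cdot> z)\<close> produces \<open>a * z\<close>.
\<close>

lemma star_circ_left:
  assumes a: "a \<in> carrier M" and b: "b \<in> carrier M" and z: "z \<in> carrier M"
    and u: "star M C a z \<in> annihilator M C" and v: "star M C b z \<in> annihilator M C"
  shows "star M C (a \<otimes>\<^bsub>C\<^esub> b) z = star M C a z \<otimes>\<^bsub>M\<^esub> star M C b z"
proof -
  let ?u = "star M C a z" and ?v = "star M C b z"
  note U = annihilatorD[OF u] and V = annihilatorD[OF v]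
  have ab: "a \<otimes>\<^bsub>C\<^esub> b \<in> carrier M" and bz: "b \<otimes>\<^bsub>M\<^esub> z \<in> carrier M"
    and abz: "a \<otimes>\<^bsub>C\<^esub> (b \<otimes>\<^bsub>M\<^esub> z) \<in> carrier M"
    using a b z C_closed by simp_all
  have bz_eq: "b \<otimes>\<^bsub>C\<^esub> z = (b \<otimes>\<^bsub>M\<^esub> z) \<otimes>\<^bsub>C\<^esub> ?v"
    using circ_eq_mult_star[OF b z] V(1) V(4)[OF z] V(3)[OF bz] b z
    by (simp add: M.m_assoc)
  have "(a \<otimes>\<^bsub>C\<^esub> b) \<otimes>\<^bsub>C\<^esub> z = a \<otimes>\<^bsub>C\<^esub> (b \<otimes>\<^bsub>M\<^esub> z) \<otimes>\<^bsub>C\<^esub> ?v"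
    using a b z V(1) bz bz_eq carrier_eq by (simp add: C.m_assoc)
  also have "\<dots> = a \<otimes>\<^bsub>C\<^esub> (b \<otimes>\<^bsub>M\<^esub> z) \<otimes>\<^bsub>M\<^esub> ?v"
    by (rule V(3)[OF abz])
  also have "a \<otimes>\<^bsub>C\<^esub> (b \<otimes>\<^bsub>M\<^esub> z) = (a \<otimes>\<^bsub>C\<^esub> b) \<otimes>\<^bsub>M\<^esub> ?u \<otimes>\<^bsub>M\<^esub> z"
    using left_brace[OF a b z] circ_eq_mult_star[OF a z] a ab z U(1)
    by (simp add: M.m_assoc) (simp add: M.m_assoc[symmetric])
  also have "(a \<otimes>\<^bsub>C\<^esub> b) \<otimes>\<^bsub>M\<^esub> ?u \<otimes>\<^bsub>M\<^esub> z \<otimes>\<^bsub>M\<^esub> ?v = (a \<otimes>\<^bsub>C\<^esub> b) \<otimes>\<^bsub>M\<^esub> (?u \<otimes>\<^bsub>M\<^esub> ?v) \<otimes>\<^bsub>M\<^esub> z"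
    using ab z U(1) V(1) V(4)[OF z] by (simp add: M.m_assoc)
  finally show ?thesis
    by (intro star_eqI) (use ab z U(1) V(1) in simp_all)
qed

end

context two_sided_skew_brace
begin

text \<open>
  The right brace law gives \<open>(b \<cdot> c) \<circ> z = b \<cdot> (b * z) \<cdot> (c \<circ> z)\<close>, and \<open>b * z\<close> commutes with \<open>c\<close>.
\<close>

lemma star_mult_left:
  assumes b: "b \<in> carrier M" and c: "c \<in> carrier M" and z: "z \<in> carrier M"
    and u: "star M C b z \<in> group_center M"
  shows "star M C (b \<otimes>\<^bsub>M\<^esub> c) z = star M C b z \<otimes>\<^bsub>M\<^esub> star M C c z"
proof -
  let ?u = "star M C b z" and ?v = "star M C c z"
  have uM: "?u \<in> carrier M" and com: "?u \<otimes>\<^bsub>M\<^esub> c = c \<otimes>\<^bsub>M\<^esub> ?u"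
    using u c unfolding group_center_def by auto
  have vM: "?v \<in> carrier M" using c z by (rule star_closed)
  have "(b \<otimes>\<^bsub>M\<^esub> c) \<otimes>\<^bsub>C\<^esub> z = (b \<otimes>\<^bsub>M\<^esub> ?u \<otimes>\<^bsub>M\<^esub> z) \<otimes>\<^bsub>M\<^esub> inv\<^bsub>M\<^esub> z \<otimes>\<^bsub>M\<^esub> (c \<otimes>\<^bsub>M\<^esub> ?v \<otimes>\<^bsub>M\<^esub> z)"
    using right_brace[OF z b c] circ_eq_mult_star b c z by simp
  also have "\<dots> = b \<otimes>\<^bsub>M\<^esub> (?u \<otimes>\<^bsub>M\<^esub> c) \<otimes>\<^bsub>M\<^esub> ?v \<otimes>\<^bsub>M\<^esub> z"
    using b c z uM vM by (simp add: M.m_assoc)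
  also have "\<dots> = (b \<otimes>\<^bsub>M\<^esub> c) \<otimes>\<^bsub>M\<^esub> (?u \<otimes>\<^bsub>M\<^esub> ?v) \<otimes>\<^bsub>M\<^esub> z"
    unfolding com using b c z uM vM by (simp add: M.m_assoc)
  finally show ?thesis
    by (intro star_eqI) (use b c z uM vM in simp_all)
qed

text \<open>
  Because \<open>a \<circ> b = a \<cdot> (a * b) \<cdot> b\<close>, the value of \<open>(_ * z)\<close> at \<open>a \<circ> b\<close> can be computed by
  \<open>star_circ_left\<close> and by \<open>star_mult_left\<close>; the two results differ by the factor
  \<open>(a * b) * z\<close>.
\<close>

lemma star_star_eq_one:
  assumes a: "a \<in> carrier M" and b: "b \<in> carrier M" and z: "z \<in> carrier M"
    and ann: "\<And>x. x \<in> carrier M \<Longrightarrow> star M C x z \<in> annihilator M C"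
  shows "star M C (star M C a b) z = \<one>\<^bsub>M\<^esub>"
proof -
  let ?f = "\<lambda>x. star M C x z" and ?s = "star M C a b"
  have cen: "?f x \<in> group_center M" if "x \<in> carrier M" for x
    using ann[OF that] unfolding annihilator_def by blast
  have s: "?s \<in> carrier M" using a b by (rule star_closed)
  have f: "?f x \<in> carrier M" if "x \<in> carrier M" for x
    using that z by (rule star_closed)
  have "?f a \<otimes>\<^bsub>M\<^esub> ?f b = ?f (a \<otimes>\<^bsub>M\<^esub> ?s \<otimes>\<^bsub>M\<^esub> b)"
    using star_circ_left[OF a b z ann[OF a] ann[OF b]] circ_eq_mult_star[OF a b] by simp
  also have "\<dots> = ?f a \<otimes>\<^bsub>M\<^esub> ?f ?s \<otimes>\<^bsub>M\<^esub> ?f b"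
    using star_mult_left[OF a s z cen] star_mult_left[OF _ b z cen] a s by simp
  finally have "?f a \<otimes>\<^bsub>M\<^esub> ?f b = ?f a \<otimes>\<^bsub>M\<^esub> ?f ?s \<otimes>\<^bsub>M\<^esub> ?f b" .
  then show ?thesis
    using f a b s by (simp add: M.right_cancel)
qed

lemma star_derived_second_annihilator:
  assumes x: "x \<in> star_set M C (carrier M) (carrier M)" and z: "z \<in> second_annihilator M C"
  shows "star M C x z = \<one>\<^bsub>M\<^esub>"
proof -
  let ?f = "\<lambda>b. star M C b z"
  have zM: "z \<in> carrier M" using z by (rule second_annihilator_closed)
  have ann: "?f b \<in> annihilator M C" if "b \<in> carrier M" for b
    using star_second_annihilator[OF z that] .
  have "?f \<in> hom M M"
    using star_mult_left[OF _ _ zM] star_closed[OF _ zM] ann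
    unfolding hom_def annihilator_def by auto
  then interpret f: group_hom M M ?f by unfold_locales
  have "{star M C a b | a b. a \<in> carrier M \<and> b \<in> carrier M} \<subseteq> kernel M M ?f"
    using star_star_eq_one[OF _ _ zM ann] star_closed unfolding kernel_def by blast
  then have "star_set M C (carrier M) (carrier M) \<subseteq> kernel M M ?f"
    unfolding star_set_def by (rule M.generate_subgroup_incl[OF _ f.subgroup_kernel])
  then show ?thesis
    using x unfolding kernel_def by blast
qed

end

theorem theorem1p7:
  fixes M :: "('a, 'm) monoid_scheme" and C :: "('a, 'n) monoid_scheme"
  assumes "two_sided_skew_brace M C"
  shows "star_set M C (star_set M C (carrier M) (carrier M)) (second_annihilator M C)
    = {\<one>\<^bsub>M\<^esub>}"
proof -
  interpret two_sided_skew_brace M C by (rule assms)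
  let ?S = "{star M C x z | x z.
    x \<in> star_set M C (carrier M) (carrier M) \<and> z \<in> second_annihilator M C}"
  have "?S \<subseteq> {\<one>\<^bsub>M\<^esub>}"
    using star_derived_second_annihilator by blast
  then have "generate M ?S \<subseteq> {\<one>\<^bsub>M\<^esub>}"
    by (rule M.generate_subgroup_incl[OF _ M.triv_subgroup])
  then show ?thesis
    unfolding star_set_def[of M C "star_set M C (carrier M) (carrier M)"]
    using generate.one by fast
qed

end
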